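(* Let $X=(X_t)_{t\in[0,T]}$ be a square-integrable process with natural filtration $(\mathcal{F}_t^X)_{t\in[0,T]}$, energy space $\mathcal{H}_X$, stochastic integral $\delta_X\colon\mathcal{H}_X\to L^2(\Omega)$, predictable projection $\Pi_X$, and operator--covariant derivative $D_X=\delta_X^*$. Assume: (i) (Centered integrals) $\mathbb{E}[\delta_X(u)]=0$ for all $u\in\mathcal{H}_X$. (ii) (Isometry on predictable processes) $\mathbb{E}[|\delta_X(u)|^2]=\|u\|_{\mathcal{H}_X}^2$ for all predictable $u\in\mathcal{H}_X$. (iii) (Representation property) Every $\mathcal{F}_T^X$-measurable $\tilde F\in L^2(\Omega)$ with $\mathbb{E}[\tilde F]=0$ can be written as $\tilde F=\delta_X(v)$ for some predictable $v\in\mathcal{H}_X$. Then for every $\mathcal{F}_T^X$-measurable $F\in L^2(\Omega)$, $$F=\mathbb{E}[F]+\delta_X(\Pi_X D_X F)=\mathbb{E}[F]+\int_0^T(\Pi_X D_X F)_t\,dX_t .$$ Equivalently, the operator identity $(\mathrm{Id}-\mathbb{E})=\delta_X\circ\Pi_X\circ D_X$ holds on $L^2(\Omega,\mathcal{F}_T^X,P)$.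
   Context: $(\Omega,\mathcal{F},P)$ is a complete probability space, $T>0$, and $L^2(\Omega)$ is the real Hilbert space of square-integrable random variables. The natural filtration $(\mathcal{F}_t^X)$ of $X$ is augmented to satisfy the usual conditions; "predictable" means measurable with respect to the predictable $\sigma$-algebra on $[0,T]\times\Omega$ of this filtration. An energy space for a square-integrable process $X$ is a real separable Hilbert space $\mathcal{H}_X$ of (equivalence classes of) processes $u=(u_t)_{t\in[0,T]}$, together with a continuous linear operator $\delta_X\colon\mathcal{H}_X\to L^2(\Omega)$, called the stochastic integral with respect to $X$. The notation $\int_0^T u_t\,dX_t$ means $\delta_X(u)$. It is assumed that $\mathcal{H}_X$ consists of jointly measurable processes and that the predictable processes form a closed linear subspace of $\mathcal{H}_X$. The predictable projection $\Pi_X\colon\mathcal{H}_X\to\mathcal{H}_X$ is the orthogonal projection onto this subspace. The operator--covariant derivative $D_X\colon L^2(\Omega)\to\mathcal{H}_X$ is the Hilbert space adjoint of $\delta_X$: for $F\in L^2(\Omega)$, $D_XF\in\mathcal{H}_X$ is the unique element with $\mathbb{E}[F\,\delta_X(u)]=\langle D_XF,u\rangle_{\mathcal{H}_X}$ for all $u\in\mathcal{H}_X$. $\mathrm{Id}$ is the identity operator and $\mathbb{E}$ is the operator sending $F$ to the constant random variable $\mathbb{E}[F]$. *)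

theory Defs
  imports "HOL-Probability.Probability"
begin

section \<open>Square-integrable random variables\<close>

text \<open>
  Elements of \<open>L\<^sup>2\<close> are handled through representatives: equality in \<open>L\<^sup>2\<close> is almost sure
  equality, and linearity and continuity of operators into \<open>L\<^sup>2\<close> are stated modulo it.
\<close>

definition L2 :: "'a measure \<Rightarrow> ('a \<Rightarrow> real) set" where
  "L2 M = {F \<in> borel_measurable M. integrable M (\<lambda>\<omega>. (F \<omega>)\<^sup>2)}"

definition L2_norm :: "'a measure \<Rightarrow> ('a \<Rightarrow> real) \<Rightarrow> real" where
  "L2_norm M F = sqrt (integral\<^sup>L M (\<lambda>\<omega>. (F \<omega>)\<^sup>2))"

section \<open>The augmented natural filtration and its predictable sigma-algebra\<close>

text \<open>Generators of the sigma-algebra generated by \<open>X s\<close>, \<open>0 \<le> s \<le> t\<close>, and all null sets.\<close>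

definition past_gens :: "'a measure \<Rightarrow> (real \<Rightarrow> 'a \<Rightarrow> real) \<Rightarrow> real \<Rightarrow> 'a set set" where
  "past_gens M X t =
     {X s -` B \<inter> space M |s B. s \<in> {0..t} \<and> B \<in> sets borel} \<union> null_sets M"

text \<open>
  The usual conditions: completion by the null sets and right-continuity. The time horizon is
  \<open>T\<close>, so at \<open>t = T\<close> there is no later time and only the completion takes effect;
  for \<open>t < T\<close> inserting \<open>T\<close> does not change the index set.
\<close>

definition natural_filtration ::
    "'a measure \<Rightarrow> real \<Rightarrow> (real \<Rightarrow> 'a \<Rightarrow> real) \<Rightarrow> real \<Rightarrow> 'a measure" where
  "natural_filtration M T X t =
     sigma (space M) (\<Inter>s \<in> insert T {t<..T}. sigma_sets (space M) (past_gens M X s))"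

definition predictable_algebra ::
    "'a measure \<Rightarrow> real \<Rightarrow> (real \<Rightarrow> 'a measure) \<Rightarrow> (real \<times> 'a) measure" where
  "predictable_algebra M T \<F> =
     sigma ({0..T} \<times> space M)
       ({{0} \<times> A |A. A \<in> sets (\<F> 0)} \<union>
        {{s<..t} \<times> A |s t A. 0 \<le> s \<and> s \<le> t \<and> t \<le> T \<and> A \<in> sets (\<F> s)})"

definition predictable ::
    "'a measure \<Rightarrow> real \<Rightarrow> (real \<Rightarrow> 'a \<Rightarrow> real) \<Rightarrow> (real \<Rightarrow> 'a \<Rightarrow> real) \<Rightarrow> bool" where
  "predictable M T X u \<longleftrightarrow>
     (\<lambda>(t, \<omega>). u t \<omega>) \<in>
       borel_measurable (predictable_algebra M T (natural_filtration M T X))"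

definition jointly_measurable :: "'a measure \<Rightarrow> real \<Rightarrow> (real \<Rightarrow> 'a \<Rightarrow> real) \<Rightarrow> bool" where
  "jointly_measurable M T u \<longleftrightarrow>
     (\<lambda>(t, \<omega>). u t \<omega>) \<in> borel_measurable (restrict_space borel {0..T} \<Otimes>\<^sub>M M)"

section \<open>Energy spaces\<close>

locale square_integrable_process = prob_space M + complete_measure M
  for M :: "'a measure" and T :: real and X :: "real \<Rightarrow> 'a \<Rightarrow> real" +
  assumes T_pos: "T > 0"
    and X_L2: "\<And>t. t \<in> {0..T} \<Longrightarrow> X t \<in> L2 M"

text \<open>Elements of the energy space that have a predictable representative.\<close>

definition predictable_elems ::
    "'a measure \<Rightarrow> real \<Rightarrow> (real \<Rightarrow> 'a \<Rightarrow> real) \<Rightarrow> (real \<Rightarrow> 'a \<Rightarrow> real) set \<Rightarrow>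
     ((real \<Rightarrow> 'a \<Rightarrow> real) \<Rightarrow> 'h) \<Rightarrow> 'h set" where
  "predictable_elems M T X V cls = cls ` {u \<in> V. predictable M T X u}"

text \<open>
  The energy space is the type \<open>'h\<close>, a complete separable real inner product space. Its elements
  are equivalence classes of processes: \<open>V\<close> is the vector space of the representing processes and
  \<open>cls\<close> maps a process to its class. The equivalence relation is the kernel of \<open>cls\<close>; it is left
  unspecified except that it relates any two functions in \<open>V\<close> that are equal as processes on
  \<open>[0,T]\<close>. The vector space operations on classes are the pointwise ones on representatives.
\<close>

locale energy_space = square_integrable_process M T X
  for M :: "'a measure" and T :: real and X :: "real \<Rightarrow> 'a \<Rightarrow> real" +
  fixes V :: "(real \<Rightarrow> 'a \<Rightarrow> real) set"
    and cls :: "(real \<Rightarrow> 'a \<Rightarrow> real) \<Rightarrow> 'h::{real_inner, polish_space}"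
    and \<delta> :: "'h \<Rightarrow> 'a \<Rightarrow> real"
  assumes V_jointly_measurable: "\<And>u. u \<in> V \<Longrightarrow> jointly_measurable M T u"
    and V_zero: "(\<lambda>t \<omega>. 0) \<in> V"
    and V_add: "\<And>u v. u \<in> V \<Longrightarrow> v \<in> V \<Longrightarrow> (\<lambda>t \<omega>. u t \<omega> + v t \<omega>) \<in> V"
    and V_scale: "\<And>c u. u \<in> V \<Longrightarrow> (\<lambda>t \<omega>. c * u t \<omega>) \<in> V"
    and cls_add: "\<And>u v. u \<in> V \<Longrightarrow> v \<in> V \<Longrightarrow>
                    cls (\<lambda>t \<omega>. u t \<omega> + v t \<omega>) = cls u + cls v"
    and cls_scale: "\<And>c u. u \<in> V \<Longrightarrow> cls (\<lambda>t \<omega>. c * u t \<omega>) = c *\<^sub>R cls u"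
    and cls_cong: "\<And>u v. u \<in> V \<Longrightarrow> v \<in> V \<Longrightarrow>
                    (\<And>t \<omega>. t \<in> {0..T} \<Longrightarrow> \<omega> \<in> space M \<Longrightarrow> u t \<omega> = v t \<omega>) \<Longrightarrow> cls u = cls v"
    and cls_surj: "cls ` V = UNIV"
    and predictable_subspace: "subspace (predictable_elems M T X V cls)"
    and predictable_closed: "closed (predictable_elems M T X V cls)"
    and \<delta>_L2: "\<And>x. \<delta> x \<in> L2 M"
    and \<delta>_add: "\<And>x y. AE \<omega> in M. \<delta> (x + y) \<omega> = \<delta> x \<omega> + \<delta> y \<omega>"
    and \<delta>_scale: "\<And>c x. AE \<omega> in M. \<delta> (c *\<^sub>R x) \<omega> = c * \<delta> x \<omega>"
    and \<delta>_continuous: "\<And>x. ((\<lambda>y. L2_norm M (\<lambda>\<omega>. \<delta> y \<omega> - \<delta> x \<omega>)) \<longlongrightarrow> 0) (at x)"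

section \<open>Predictable projection and operator-covariant derivative\<close>

definition orth_proj :: "'h::real_inner set \<Rightarrow> 'h \<Rightarrow> 'h" where
  "orth_proj S x = (THE p. p \<in> S \<and> (\<forall>s\<in>S. orthogonal (x - p) s))"

definition predictable_proj ::
    "'a measure \<Rightarrow> real \<Rightarrow> (real \<Rightarrow> 'a \<Rightarrow> real) \<Rightarrow> (real \<Rightarrow> 'a \<Rightarrow> real) set \<Rightarrow>
     ((real \<Rightarrow> 'a \<Rightarrow> real) \<Rightarrow> 'h::real_inner) \<Rightarrow> 'h \<Rightarrow> 'h" where
  "predictable_proj M T X V cls = orth_proj (predictable_elems M T X V cls)"

text \<open>
  The Hilbert space adjoint of \<open>\<delta>\<close>. The library constant \<^const>\<open>adjoint\<close> is not applicable,
  since \<open>L\<^sup>2\<close> is not a type of class \<^class>\<open>real_inner\<close>.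
\<close>

definition cov_deriv ::
    "'a measure \<Rightarrow> ('h::real_inner \<Rightarrow> 'a \<Rightarrow> real) \<Rightarrow> ('a \<Rightarrow> real) \<Rightarrow> 'h" where
  "cov_deriv M \<delta> F = (THE d. \<forall>x. integral\<^sup>L M (\<lambda>\<omega>. F \<omega> * \<delta> x \<omega>) = d \<bullet> x)"

end

theory Submission
  imports Defs
begin

text \<open>
  Fix \<open>F\<close> in \<open>L\<^sup>2\<close>, measurable at time \<open>T\<close>. The representation property applied to \<open>F - E F\<close>
  gives a predictable \<open>v\<close> with \<open>F = E F + \<delta> v\<close> almost surely, so everything comes down to
  \<open>\<Pi> (D F) = v\<close>. For predictable \<open>s\<close>,
  \<open>\<langle>D F, s\<rangle> = E[F \<delta> s] = E F E[\<delta> s] + E[\<delta> v \<delta> s] = \<langle>v, s\<rangle>\<close>: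
  the first equality is the adjoint relation, and the last one combines centering with the
  polarized isometry. Hence \<open>D F - v\<close> is orthogonal to the predictable elements, which
  characterizes the predictable element \<open>v\<close> as the projection of \<open>D F\<close>
  (\<open>predictable_proj_cov_deriv_eq\<close>).

  The existence of \<open>D F\<close> itself is the Riesz representation theorem (\<open>riesz_representation\<close>)
  applied to the functional \<open>x \<mapsto> E[F \<delta> x]\<close>, whose boundedness follows from the continuity
  of \<open>\<delta>\<close> at the origin (\<open>bounded_linear_expectation_mult\<close>).
\<close>

section \<open>Riesz representation and orthogonal projection\<close>

lemma bounded_linear_if_bounded_on_ball:
  fixes f :: "'h::real_normed_vector \<Rightarrow> real"
  assumes "linear f" and "r > 0" and bound: "\<And>x. norm x < r \<Longrightarrow> \<bar>f x\<bar> \<le> C"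
  shows "bounded_linear f"
proof -
  interpret linear f by fact
  have "norm (f x) \<le> norm x * (2 * C / r)" for x
  proof (cases "x = 0")
    case False
    define c where "c = r / (2 * norm x)"
    have "c > 0" using False \<open>r > 0\<close> by (simp add: c_def)
    have "norm (c *\<^sub>R x) < r"
      using False \<open>r > 0\<close> by (simp add: c_def)
    then have "\<bar>f (c *\<^sub>R x)\<bar> \<le> C" by (rule bound)
    then have "c * \<bar>f x\<bar> \<le> C"
      using \<open>c > 0\<close> by (simp add: scale abs_mult)
    then show ?thesis
      using False \<open>r > 0\<close> by (simp add: c_def field_simps)
  qed (simp add: zero)
  then show ?thesis
    by (intro bounded_linear_intro[where K = "2 * C / r"]) (auto simp: add scale)
qed

text \<open>
  The representing vector is the minimizer of the energy \<open>J x = \<parallel>x\<parallel>\<^sup>2 / 2 - f x\<close>: boundedness of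
  \<open>f\<close> makes \<open>J\<close> bounded below, the parallelogram law makes minimizing sequences Cauchy, and the
  vanishing of the first variation of \<open>J\<close> at the minimizer is the required identity.
\<close>

lemma riesz_representation:
  fixes f :: "'h::{real_inner, complete_space} \<Rightarrow> real"
  assumes "bounded_linear f"
  obtains d where "\<And>x. f x = d \<bullet> x"
proof -
  interpret bounded_linear f by fact
  define J where "J = (\<lambda>x. (norm x)\<^sup>2 / 2 - f x)"
  define m where "m = (INF x. J x)"
  obtain K where K: "\<And>x. norm (f x) \<le> norm x * K" using bounded by blast
  have "- (K\<^sup>2 / 2) \<le> J x" for x
  proof -
    have "f x \<le> norm x * K" using K[of x] by simp
    moreover have "0 \<le> (norm x - K)\<^sup>2" by simp
    ultimately show ?thesis by (simp add: J_def power2_eq_square algebra_simps)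
  qed
  then have bdd: "bdd_below (range J)" by (auto intro!: bdd_belowI)
  have m_le: "m \<le> J x" for x
    unfolding m_def by (rule cINF_lower[OF bdd]) simp
  have "\<exists>x. J x < m + inverse (real (Suc n))" for n
    using cINF_less_iff[of UNIV J "m + inverse (real (Suc n))"] bdd by (auto simp: m_def)
  then obtain s where s: "\<And>n. J (s n) < m + inverse (real (Suc n))" by metis
  have parallelogram: "(norm (x - y))\<^sup>2 / 8 = J x / 2 + J y / 2 - J ((1/2) *\<^sub>R (x + y))" for x y
    by (simp add: J_def scale add power2_norm_eq_inner inner_add_left inner_add_right
        inner_diff_left inner_diff_right inner_commute field_simps)
  have "Cauchy s"
  proof (rule CauchyI)
    fix e :: real assume "e > 0"
    \<comment> \<open>By the parallelogram identity the squared distance of two \<open>\<eta>\<close>-minimizers is below \<open>8 \<eta>\<close>.\<close>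
    then obtain N where N: "inverse (real (Suc N)) < e\<^sup>2 / 8"
      using reals_Archimedean[of "e\<^sup>2 / 8"] by auto
    have near: "J (s n) < m + e\<^sup>2 / 8" if "n \<ge> N" for n
    proof -
      have "inverse (real (Suc n)) \<le> inverse (real (Suc N))"
        using that by (intro le_imp_inverse_le) auto
      then show ?thesis using s[of n] N by linarith
    qed
    have "norm (s k - s n) < e" if "k \<ge> N" "n \<ge> N" for k n
    proof -
      have "(norm (s k - s n))\<^sup>2 < e\<^sup>2"
        using near[OF that(1)] near[OF that(2)] m_le[of "(1/2) *\<^sub>R (s k + s n)"]
          parallelogram[of "s k" "s n"]
        by linarith
      then show ?thesis using \<open>e > 0\<close> by (simp add: power2_less_imp_less)
    qed
    then show "\<exists>N. \<forall>k\<ge>N. \<forall>n\<ge>N. norm (s k - s n) < e" by blast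
  qed
  then obtain d where d: "s \<longlonglongrightarrow> d"
    using Cauchy_convergent convergent_def by blast
  have "(\<lambda>n. J (s n)) \<longlonglongrightarrow> J d"
    unfolding J_def by (intro tendsto_intros tendsto d) simp
  moreover have "(\<lambda>n. m + inverse (real (Suc n))) \<longlonglongrightarrow> m + 0"
    by (intro tendsto_intros LIMSEQ_inverse_real_of_nat)
  ultimately have "J d \<le> m + 0"
    by (rule LIMSEQ_le) (use s less_imp_le in blast)
  then have min: "J d \<le> J x" for x
    using m_le[of x] by linarith
  have "f x = d \<bullet> x" for x
  proof -
    define a where "a = d \<bullet> x - f x"
    have variation: "0 \<le> t * a + t\<^sup>2 * (norm x)\<^sup>2 / 2" for t
    proof -
      have "(norm (d + t *\<^sub>R x))\<^sup>2 = (norm d)\<^sup>2 + 2 * t * (d \<bullet> x) + t\<^sup>2 * (norm x)\<^sup>2"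
        unfolding power2_norm_eq_inner
        by (simp add: inner_add_left inner_add_right inner_commute[of x d] power2_eq_square algebra_simps)
      then show ?thesis
        using min[of "d + t *\<^sub>R x"] by (simp add: J_def a_def scale add field_simps)
    qed
    \<comment> \<open>This \<open>t\<close> makes the quadratic negative unless \<open>a = 0\<close>; adding \<open>1\<close> to the
      denominator covers the degenerate case \<open>x = 0\<close>.\<close>
    define q where "q = (norm x)\<^sup>2 + 1"
    have "q > 0" by (simp add: q_def add_nonneg_pos)
    have "0 \<le> (- a / q) * a + (- a / q)\<^sup>2 * (norm x)\<^sup>2 / 2" by (rule variation)
    also have "\<dots> \<le> (- a / q) * a + (- a / q)\<^sup>2 * q / 2"
      by (intro add_left_mono divide_right_mono mult_left_mono) (auto simp: q_def)
    also have "\<dots> = - (a\<^sup>2 / (2 * q))"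
      using \<open>q > 0\<close> by (simp add: power2_eq_square field_simps)
    finally have "a\<^sup>2 \<le> 0"
      using \<open>q > 0\<close> by (simp add: divide_le_0_iff)
    then show ?thesis by (simp add: a_def)
  qed
  then show thesis by (rule that)
qed

text \<open>
  A vector of \<open>S\<close> that acts on \<open>S\<close> like \<open>x\<close> is the projection of \<open>x\<close>: the difference of two such
  vectors lies in \<open>S\<close> and is orthogonal to itself. Exhibiting a candidate thus settles existence
  as well.
\<close>

lemma orth_proj_eqI:
  assumes "subspace S" and "p \<in> S" and "\<And>s. s \<in> S \<Longrightarrow> x \<bullet> s = p \<bullet> s"
  shows "orth_proj S x = p"
  unfolding orth_proj_def
proof (rule the_equality)
  show "p \<in> S \<and> (\<forall>s\<in>S. orthogonal (x - p) s)"
    using assms by (simp add: orthogonal_def inner_diff_left)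
next
  fix q assume q: "q \<in> S \<and> (\<forall>s\<in>S. orthogonal (x - q) s)"
  then have "q - p \<in> S" using assms by (simp add: subspace_diff)
  then have "(x - q) \<bullet> (q - p) = 0" and "x \<bullet> (q - p) = p \<bullet> (q - p)"
    using q assms(3) by (auto simp: orthogonal_def)
  then have "(q - p) \<bullet> (q - p) = 0" by (simp add: inner_diff_left)
  then show "q = p" by simp
qed

section \<open>Products in L2\<close>

text \<open>
  Both facts are integrated forms of the pointwise inequality \<open>2 \<bar>F G\<bar> \<le> F\<^sup>2 + G\<^sup>2\<close>. The bound is
  not homogeneous, but it suffices on a ball, and linearity then rescales it to the whole space.
\<close>

lemma
  assumes F: "F \<in> L2 M" and G: "G \<in> L2 M"
  shows integrable_mult_L2: "integrable M (\<lambda>\<omega>. F \<omega> * G \<omega>)"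
    and abs_integral_mult_L2_le:
      "\<bar>\<integral>\<omega>. F \<omega> * G \<omega> \<partial>M\<bar> \<le> ((\<integral>\<omega>. (F \<omega>)\<^sup>2 \<partial>M) + (\<integral>\<omega>. (G \<omega>)\<^sup>2 \<partial>M)) / 2"
proof -
  have [measurable]: "F \<in> borel_measurable M" "G \<in> borel_measurable M"
    and int: "integrable M (\<lambda>\<omega>. (F \<omega>)\<^sup>2)" "integrable M (\<lambda>\<omega>. (G \<omega>)\<^sup>2)"
    using F G by (auto simp: L2_def)
  then have dom: "integrable M (\<lambda>\<omega>. ((F \<omega>)\<^sup>2 + (G \<omega>)\<^sup>2) / 2)" by simp
  have le: "\<bar>a * b\<bar> \<le> (a\<^sup>2 + b\<^sup>2) / 2" for a b :: real
    using sum_squares_bound[of "\<bar>a\<bar>" "\<bar>b\<bar>"] by (simp add: abs_mult)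
  show prod: "integrable M (\<lambda>\<omega>. F \<omega> * G \<omega>)"
  proof (rule Bochner_Integration.integrable_bound[OF dom])
    show "AE \<omega> in M. norm (F \<omega> * G \<omega>) \<le> norm (((F \<omega>)\<^sup>2 + (G \<omega>)\<^sup>2) / 2)"
      unfolding real_norm_def by (intro AE_I2 order_trans[OF le abs_ge_self])
  qed simp
  have "\<bar>\<integral>\<omega>. F \<omega> * G \<omega> \<partial>M\<bar> \<le> (\<integral>\<omega>. \<bar>F \<omega> * G \<omega>\<bar> \<partial>M)" by (rule integral_abs_bound)
  also have "\<dots> \<le> (\<integral>\<omega>. ((F \<omega>)\<^sup>2 + (G \<omega>)\<^sup>2) / 2 \<partial>M)"
    by (intro integral_mono le dom integrable_abs prod)
  also have "\<dots> = ((\<integral>\<omega>. (F \<omega>)\<^sup>2 \<partial>M) + (\<integral>\<omega>. (G \<omega>)\<^sup>2 \<partial>M)) / 2"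
    using int by simp
  finally show "\<bar>\<integral>\<omega>. F \<omega> * G \<omega> \<partial>M\<bar> \<le> ((\<integral>\<omega>. (F \<omega>)\<^sup>2 \<partial>M) + (\<integral>\<omega>. (G \<omega>)\<^sup>2 \<partial>M)) / 2" .
qed

lemma (in prob_space) integrable_L2: "F \<in> L2 M \<Longrightarrow> integrable M F"
  by (auto simp: L2_def intro: square_integrable_imp_integrable)

lemma (in prob_space) L2_diff_const:
  assumes "F \<in> L2 M"
  shows "(\<lambda>\<omega>. F \<omega> - c) \<in> L2 M"
  using assms integrable_L2[OF assms] by (auto simp: L2_def power2_diff)

section \<open>The operator-covariant derivative\<close>

context energy_space
begin

lemma \<delta>_measurable [measurable]: "\<delta> x \<in> borel_measurable M"
  using \<delta>_L2[of x] by (simp add: L2_def)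

lemma linear_expectation_mult:
  assumes "F \<in> L2 M"
  shows "linear (\<lambda>x. \<integral>\<omega>. F \<omega> * \<delta> x \<omega> \<partial>M)"
proof (rule linearI)
  have [measurable]: "F \<in> borel_measurable M" using assms by (simp add: L2_def)
  show "(\<integral>\<omega>. F \<omega> * \<delta> (x + y) \<omega> \<partial>M) = (\<integral>\<omega>. F \<omega> * \<delta> x \<omega> \<partial>M) + (\<integral>\<omega>. F \<omega> * \<delta> y \<omega> \<partial>M)" for x y
  proof -
    have "(\<integral>\<omega>. F \<omega> * \<delta> (x + y) \<omega> \<partial>M) = (\<integral>\<omega>. F \<omega> * \<delta> x \<omega> + F \<omega> * \<delta> y \<omega> \<partial>M)"
      by (rule integral_cong_AE) (use \<delta>_add[of x y] in \<open>auto simp: distrib_left\<close>)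
    then show ?thesis using assms by (simp add: integrable_mult_L2 \<delta>_L2)
  qed
  show "(\<integral>\<omega>. F \<omega> * \<delta> (c *\<^sub>R x) \<omega> \<partial>M) = c *\<^sub>R (\<integral>\<omega>. F \<omega> * \<delta> x \<omega> \<partial>M)" for c x
  proof -
    have "(\<integral>\<omega>. F \<omega> * \<delta> (c *\<^sub>R x) \<omega> \<partial>M) = (\<integral>\<omega>. c * (F \<omega> * \<delta> x \<omega>) \<partial>M)"
      by (rule integral_cong_AE) (use \<delta>_scale[of c x] in auto)
    then show ?thesis by simp
  qed
qed

lemma \<delta>_zero: "AE \<omega> in M. \<delta> 0 \<omega> = 0"
  using \<delta>_scale[of 0 0] by simp

text \<open>
  Continuity of \<open>\<delta>\<close> at \<open>0\<close> keeps \<open>E[(\<delta> x)\<^sup>2]\<close> below \<open>1\<close> on some ball around \<open>0\<close>, and there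
  \<open>E[F \<delta> x]\<close> is at most \<open>(E[F\<^sup>2] + 1) / 2\<close> in absolute value.
\<close>

lemma bounded_linear_expectation_mult:
  assumes "F \<in> L2 M"
  shows "bounded_linear (\<lambda>x. \<integral>\<omega>. F \<omega> * \<delta> x \<omega> \<partial>M)"
proof -
  have "eventually (\<lambda>y. L2_norm M (\<lambda>\<omega>. \<delta> y \<omega> - \<delta> 0 \<omega>) < 1) (at 0)"
    by (rule order_tendstoD(2)[OF \<delta>_continuous]) simp
  then obtain r where "r > 0"
    and r: "\<And>x. x \<noteq> 0 \<Longrightarrow> norm x < r \<Longrightarrow> L2_norm M (\<lambda>\<omega>. \<delta> x \<omega> - \<delta> 0 \<omega>) < 1"
    by (auto simp: eventually_at)
  have norm_\<delta>: "L2_norm M (\<lambda>\<omega>. \<delta> x \<omega> - \<delta> 0 \<omega>) = sqrt (\<integral>\<omega>. (\<delta> x \<omega>)\<^sup>2 \<partial>M)" for x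
  proof -
    have "(\<integral>\<omega>. (\<delta> x \<omega> - \<delta> 0 \<omega>)\<^sup>2 \<partial>M) = (\<integral>\<omega>. (\<delta> x \<omega>)\<^sup>2 \<partial>M)"
      by (rule integral_cong_AE) (use \<delta>_zero in auto)
    then show ?thesis by (simp add: L2_norm_def)
  qed
  have le1: "(\<integral>\<omega>. (\<delta> x \<omega>)\<^sup>2 \<partial>M) \<le> 1" if "norm x < r" for x
  proof (cases "x = 0")
    case True
    have "(\<integral>\<omega>. (\<delta> 0 \<omega>)\<^sup>2 \<partial>M) = (\<integral>\<omega>. 0 \<partial>M)"
      by (rule integral_cong_AE) (use \<delta>_zero in auto)
    then show ?thesis using True by simp
  next
    case False
    then show ?thesis using r[OF False that] by (simp add: norm_\<delta>)
  qed
  show ?thesis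
  proof (rule bounded_linear_if_bounded_on_ball[OF linear_expectation_mult[OF assms] \<open>r > 0\<close>])
    fix x :: 'h assume "norm x < r"
    then show "\<bar>\<integral>\<omega>. F \<omega> * \<delta> x \<omega> \<partial>M\<bar> \<le> ((\<integral>\<omega>. (F \<omega>)\<^sup>2 \<partial>M) + 1) / 2"
      using le1[of x] by (intro order_trans[OF abs_integral_mult_L2_le[OF assms \<delta>_L2]]) simp
  qed
qed

text \<open>
  The definite description in \<^const>\<open>cov_deriv\<close> denotes: Riesz representation gives existence, and
  two vectors with the same inner products coincide.
\<close>

lemma inner_cov_deriv:
  assumes "F \<in> L2 M"
  shows "cov_deriv M \<delta> F \<bullet> x = (\<integral>\<omega>. F \<omega> * \<delta> x \<omega> \<partial>M)"
proof -
  obtain d where d: "\<And>x. (\<integral>\<omega>. F \<omega> * \<delta> x \<omega> \<partial>M) = d \<bullet> x"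
    using riesz_representation[OF bounded_linear_expectation_mult[OF assms]] by blast
  have "cov_deriv M \<delta> F = d"
    unfolding cov_deriv_def d
  proof (rule the_equality)
    fix d' assume "\<forall>x. d \<bullet> x = d' \<bullet> x"
    then have "(d' - d) \<bullet> (d' - d) = 0" by (simp add: inner_diff_left)
    then show "d' = d" by simp
  qed simp
  then show ?thesis by (simp add: d)
qed

section \<open>The projected derivative is the representing integrand\<close>

text \<open>
  Polarization: as \<open>x + y\<close> is again predictable, the isometry applies to it and determines the
  mixed term.
\<close>

lemma inner_eq_expectation_mult:
  assumes isometry: "\<And>x. x \<in> predictable_elems M T X V cls \<Longrightarrow>
      (\<integral>\<omega>. (\<delta> x \<omega>)\<^sup>2 \<partial>M) = (norm x)\<^sup>2"
    and x: "x \<in> predictable_elems M T X V cls" and y: "y \<in> predictable_elems M T X V cls"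
  shows "(\<integral>\<omega>. \<delta> x \<omega> * \<delta> y \<omega> \<partial>M) = x \<bullet> y"
proof -
  have int: "integrable M (\<lambda>\<omega>. (\<delta> z \<omega>)\<^sup>2)" for z
    using \<delta>_L2[of z] by (simp add: L2_def)
  have mix: "integrable M (\<lambda>\<omega>. \<delta> x \<omega> * \<delta> y \<omega>)" by (intro integrable_mult_L2 \<delta>_L2)
  have "x + y \<in> predictable_elems M T X V cls"
    using predictable_subspace x y by (rule subspace_add)
  then have "(norm (x + y))\<^sup>2 = (\<integral>\<omega>. (\<delta> (x + y) \<omega>)\<^sup>2 \<partial>M)" by (simp add: isometry)
  also have "\<dots> = (\<integral>\<omega>. (\<delta> x \<omega>)\<^sup>2 + (\<delta> y \<omega>)\<^sup>2 + 2 * (\<delta> x \<omega> * \<delta> y \<omega>) \<partial>M)"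
    by (rule integral_cong_AE) (use \<delta>_add[of x y] in \<open>auto simp: power2_sum\<close>)
  also have "\<dots> = (norm x)\<^sup>2 + (norm y)\<^sup>2 + 2 * (\<integral>\<omega>. \<delta> x \<omega> * \<delta> y \<omega> \<partial>M)"
    using int mix by (simp add: isometry x y)
  finally show ?thesis
    by (simp add: power2_norm_eq_inner inner_add_left inner_add_right inner_commute[of y x])
qed

text \<open>
  Tested against a predictable \<open>s\<close>, the constant \<open>c\<close> contributes nothing because \<open>\<delta> s\<close> is centered,
  and \<open>\<delta> v\<close> contributes \<open>\<langle>v, s\<rangle>\<close> by the polarized isometry.
\<close>

lemma predictable_proj_cov_deriv_eq:
  assumes centered: "\<And>x. (\<integral>\<omega>. \<delta> x \<omega> \<partial>M) = 0"
    and isometry: "\<And>x. x \<in> predictable_elems M T X V cls \<Longrightarrow>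
      (\<integral>\<omega>. (\<delta> x \<omega>)\<^sup>2 \<partial>M) = (norm x)\<^sup>2"
    and F: "F \<in> L2 M"
    and v: "v \<in> predictable_elems M T X V cls"
    and repr: "AE \<omega> in M. F \<omega> = c + \<delta> v \<omega>"
  shows "predictable_proj M T X V cls (cov_deriv M \<delta> F) = v"
  unfolding predictable_proj_def
proof (rule orth_proj_eqI[OF predictable_subspace v])
  fix s assume s: "s \<in> predictable_elems M T X V cls"
  have [measurable]: "F \<in> borel_measurable M" using F by (simp add: L2_def)
  have "cov_deriv M \<delta> F \<bullet> s = (\<integral>\<omega>. F \<omega> * \<delta> s \<omega> \<partial>M)" by (rule inner_cov_deriv[OF F])
  also have "\<dots> = (\<integral>\<omega>. c * \<delta> s \<omega> + \<delta> v \<omega> * \<delta> s \<omega> \<partial>M)"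
    by (rule integral_cong_AE) (use repr in \<open>auto simp: distrib_right\<close>)
  also have "\<dots> = v \<bullet> s"
    by (simp add: integrable_mult_L2 \<delta>_L2 integrable_L2 centered
        inner_eq_expectation_mult[OF isometry v s])
  finally show "cov_deriv M \<delta> F \<bullet> s = v \<bullet> s" .
qed

end

section \<open>The Clark-Ocone formula\<close>

theorem theorem3p12:
  fixes M :: "'a measure" and T :: real and X :: "real \<Rightarrow> 'a \<Rightarrow> real"
    and V :: "(real \<Rightarrow> 'a \<Rightarrow> real) set"
    and cls :: "(real \<Rightarrow> 'a \<Rightarrow> real) \<Rightarrow> 'h::{real_inner, polish_space}"
    and \<delta> :: "'h \<Rightarrow> 'a \<Rightarrow> real"
  assumes "energy_space M T X V cls \<delta>"
    and centered: "\<And>x. integral\<^sup>L M (\<delta> x) = 0"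
    and isometry: "\<And>x. x \<in> predictable_elems M T X V cls \<Longrightarrow>
          integral\<^sup>L M (\<lambda>\<omega>. \<bar>\<delta> x \<omega>\<bar>\<^sup>2) = (norm x)\<^sup>2"
    and representation: "\<And>G. G \<in> L2 M \<Longrightarrow>
          G \<in> borel_measurable (natural_filtration M T X T) \<Longrightarrow> integral\<^sup>L M G = 0 \<Longrightarrow>
          \<exists>v \<in> predictable_elems M T X V cls. AE \<omega> in M. G \<omega> = \<delta> v \<omega>"
  shows "(\<forall>F \<in> L2 M \<inter> borel_measurable (natural_filtration M T X T).
            AE \<omega> in M. F \<omega> =
              integral\<^sup>L M F + \<delta> (predictable_proj M T X V cls (cov_deriv M \<delta> F)) \<omega>)
       \<and> (\<forall>F \<in> L2 M \<inter> borel_measurable (natural_filtration M T X T).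
            AE \<omega> in M. F \<omega> - integral\<^sup>L M F =
              (\<delta> \<circ> predictable_proj M T X V cls \<circ> cov_deriv M \<delta>) F \<omega>)"
proof -
  interpret energy_space M T X V cls \<delta> by fact
  have main: "AE \<omega> in M. F \<omega> =
      integral\<^sup>L M F + \<delta> (predictable_proj M T X V cls (cov_deriv M \<delta> F)) \<omega>"
    if F: "F \<in> L2 M" and meas: "F \<in> borel_measurable (natural_filtration M T X T)" for F
  proof -
    define c where "c = integral\<^sup>L M F"
    have "(\<integral>\<omega>. F \<omega> - c \<partial>M) = 0"
      using integrable_L2[OF F] by (simp add: c_def prob_space)
    then obtain v where v: "v \<in> predictable_elems M T X V cls"
      and repr: "AE \<omega> in M. F \<omega> - c = \<delta> v \<omega>"
      using representation[OF L2_diff_const[OF F, of c]] meas by auto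
    have repr': "AE \<omega> in M. F \<omega> = c + \<delta> v \<omega>" using repr by eventually_elim simp
    have "predictable_proj M T X V cls (cov_deriv M \<delta> F) = v"
      by (rule predictable_proj_cov_deriv_eq[OF centered _ F v repr']) (simp add: isometry[symmetric])
    then show ?thesis using repr' by (simp add: c_def)
  qed
  moreover have "AE \<omega> in M. F \<omega> - integral\<^sup>L M F =
      (\<delta> \<circ> predictable_proj M T X V cls \<circ> cov_deriv M \<delta>) F \<omega>"
    if "F \<in> L2 M" "F \<in> borel_measurable (natural_filtration M T X T)" for F
    using main[OF that] by eventually_elim simp
  ultimately show ?thesis by blast
qed

end
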